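(* Let $h:(0,+\infty)\to[0,+\infty)$ be a real positive, continuous, unbounded and increasing function which is eventually semi-additive. Let $\{s_n\}_{n>0}$ be an increasing sequence of numbers that is $h$-thin. Then the alternating set of primes ${\cal H}(\{s_n\})$ has no $h$-density.
   Context: For real $x>0$, $\pi(x)$ is the number of primes $\le x$; for a set $S$ of primes, $\pi_S(x)=|\{q\in S: q\le x\}|$. A function $h$ is eventually semi-additive if there exists $M>0$ such that $h(x+y)\le h(x)+h(y)$ for all $x\ge y>M$. An increasing sequence $\{s_n\}_{n>0}$ is $h$-thin if there is a real $r>3$ such that $r\,h(\pi(s_n))<h(\pi(s_{n+1}))$ for all but finitely many $n$. The alternating set of primes associated with $\{s_n\}$ is ${\cal H}(\{s_n\})=\mathbb{P}\cap\bigcup_{k\ge 1}(s_{2k},s_{2k+1})$, where $\mathbb{P}$ is the set of primes. For a set $S$ of primes, the lower and upper $h$-densities are $\liminf_{n\to\infty} h(\pi_S(n))/h(\pi(n))$ and $\limsup_{n\to\infty} h(\pi_S(n))/h(\pi(n))$ (over natural numbers $n$); $S$ has $h$-density if these coincide. *)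

theory Defs
  imports "HOL-Analysis.Analysis" "HOL-Computational_Algebra.Primes"
begin

text \<open>
  A function \<open>h : (0,\<infinity>) \<rightarrow> [0,\<infinity>)\<close> is a total function \<open>h :: real \<Rightarrow> real\<close> of which only
  the restriction to \<open>{0<..}\<close> is constrained. A sequence \<open>{s_n}_{n>0}\<close> is a function
  \<open>s :: nat \<Rightarrow> real\<close> whose value at \<open>0\<close> is irrelevant.
\<close>

definition prime_pi_in :: "nat set \<Rightarrow> real \<Rightarrow> nat" where
  "prime_pi_in S x = card {q \<in> S. real q \<le> x}"

definition prime_pi :: "real \<Rightarrow> nat" where
  "prime_pi = prime_pi_in {q. prime q}"

definition eventually_semi_additive :: "(real \<Rightarrow> real) \<Rightarrow> bool" where
  "eventually_semi_additive h \<longleftrightarrow>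
     (\<exists>M>0. \<forall>x y. x \<ge> y \<and> y > M \<longrightarrow> h (x + y) \<le> h x + h y)"

text \<open>
  The conjunct \<open>prime_pi (s n) > 0\<close> says that \<open>h\<close> is evaluated inside its domain \<open>(0,\<infinity>)\<close>;
  without it, a sequence with all terms below \<open>2\<close> could be thin because of the
  meaningless value \<open>h 0\<close>.
\<close>

definition h_thin :: "(real \<Rightarrow> real) \<Rightarrow> (nat \<Rightarrow> real) \<Rightarrow> bool" where
  "h_thin h s \<longleftrightarrow>
     (\<exists>r::real. r > 3 \<and>
        (\<forall>\<^sub>F n in sequentially. prime_pi (s n) > 0 \<and>
           r * h (real (prime_pi (s n))) < h (real (prime_pi (s (Suc n))))))"

definition alternating_primes :: "(nat \<Rightarrow> real) \<Rightarrow> nat set" where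
  "alternating_primes s =
     {p. prime p} \<inter> (\<Union>k\<in>{1..}. {p. real p \<in> {s (2 * k)<..<s (2 * k + 1)}})"

text \<open>
  For nonempty \<open>S\<close> and all large \<open>n\<close>, \<open>h\<close> is evaluated at positive arguments only. For
  \<open>S = {}\<close> the quotient is \<open>h 0 / h (prime_pi n)\<close>, which tends to \<open>0\<close> for unbounded
  increasing \<open>h\<close> whatever the value \<open>h 0\<close>.
\<close>

definition lower_h_density :: "(real \<Rightarrow> real) \<Rightarrow> nat set \<Rightarrow> ereal" where
  "lower_h_density h S =
     liminf (\<lambda>n. ereal (h (real (prime_pi_in S (real n))) / h (real (prime_pi (real n)))))"

definition upper_h_density :: "(real \<Rightarrow> real) \<Rightarrow> nat set \<Rightarrow> ereal" where
  "upper_h_density h S =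
     limsup (\<lambda>n. ereal (h (real (prime_pi_in S (real n))) / h (real (prime_pi (real n)))))"

definition has_h_density :: "(real \<Rightarrow> real) \<Rightarrow> nat set \<Rightarrow> bool" where
  "has_h_density h S \<longleftrightarrow> lower_h_density h S = upper_h_density h S"

end

theory Submission imports Defs begin

text \<open>
  Semi-additivity for large arguments gives \<open>h (a + b) \<le> h a + h b + C\<close> for all positive \<open>a\<close>
  and \<open>b\<close>. Up to \<open>s (2k)\<close> the set contains only primes below \<open>s (2k - 1)\<close>, so its quotient
  there is below \<open>1 / r < 1 / 3\<close>. Up to \<open>s (2k + 1)\<close> it misses only the primes up to \<open>s (2k)\<close> and
  possibly \<open>s (2k + 1)\<close> itself, so the quotient there is at least
  \<open>1 - 1 / r - O(1 / h (\<pi> (s (2k + 1))))\<close>, hence eventually above \<open>1 / 2\<close>.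
\<close>

lemma finite_nat_real_le: "finite {q \<in> S. real q \<le> x}"
  by (rule finite_subset[of _ "{..nat \<lfloor>x\<rfloor>}"]) (auto simp: le_nat_iff le_floor_iff)

lemma prime_pi_in_mono: "S \<subseteq> T \<Longrightarrow> x \<le> y \<Longrightarrow> prime_pi_in S x \<le> prime_pi_in T y"
  unfolding prime_pi_in_def by (intro card_mono finite_nat_real_le) auto

lemma prime_pi_mono: "x \<le> y \<Longrightarrow> prime_pi x \<le> prime_pi y"
  unfolding prime_pi_def by (rule prime_pi_in_mono) auto

text \<open>The densities sample natural arguments while \<open>s n\<close> is real; this transfers
  counts from one to the other. For negative \<open>x\<close> the left side would still count
  \<open>0\<close> if \<open>0\<close> lies in \<open>S\<close>.\<close>

lemma prime_pi_in_nat_floor: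
  assumes "x \<ge> 0"
  shows "prime_pi_in S (real (nat \<lfloor>x\<rfloor>)) = prime_pi_in S x"
proof -
  have "real q \<le> real (nat \<lfloor>x\<rfloor>) \<longleftrightarrow> real q \<le> x" for q
    unfolding of_nat_le_iff using assms by (simp add: le_nat_iff le_floor_iff)
  then show ?thesis
    unfolding prime_pi_in_def by simp
qed

text \<open>Raising each argument to at least some \<open>m > M\<close> makes semi-additivity
  applicable and costs at most \<open>h m\<close> per argument. This allows small summands, such as
  the \<open>1\<close> contributed by an endpoint prime.\<close>

lemma semi_additive_up_to_constant:
  assumes "\<And>x. x > 0 \<Longrightarrow> h x \<ge> 0" and mono: "mono_on {0<..} h"
    and "eventually_semi_additive h"
  obtains C where "C \<ge> 0" "\<And>a b. a > 0 \<Longrightarrow> b > 0 \<Longrightarrow> h (a + b) \<le> h a + h b + C"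
proof -
  obtain M where M: "M > 0" "\<And>x y. x \<ge> y \<Longrightarrow> y > M \<Longrightarrow> h (x + y) \<le> h x + h y"
    using assms(3) unfolding eventually_semi_additive_def by blast
  define m where "m = M + 1"
  have m: "m > 0" "m > M" using M(1) by (auto simp: m_def)
  have hmax: "h (max a m) \<le> h a + h m" if "a > 0" for a
    using assms(1)[OF that] assms(1)[OF m(1)] by (auto simp: max_def)
  have "h (a + b) \<le> h a + h b + 2 * h m" if "a > 0" "b > 0" for a b
  proof -
    have "h (a + b) \<le> h (max a m + max b m)"
      using that by (intro mono_onD[OF mono]) auto
    also have "\<dots> \<le> h (max a m) + h (max b m)"
      \<comment> \<open>Semi-additivity wants the larger argument first, so both orders are
        supplied.\<close>
      using M(2)[of "max a m" "max b m"] M(2)[of "max b m" "max a m"] m(2)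
      by (smt (verit) add.commute max.cobounded2)
    also have "\<dots> \<le> h a + h b + 2 * h m"
      using hmax[OF that(1)] hmax[OF that(2)] by simp
    finally show ?thesis .
  qed
  with assms(1)[OF m(1)] show ?thesis
    by (intro that[of "2 * h m"]) auto
qed

lemma filterlim_at_top_of_ratio:
  fixes a :: "nat \<Rightarrow> real"
  assumes "r > 1" and "\<forall>\<^sub>F n in sequentially. a n \<ge> 0 \<and> r * a n < a (Suc n)"
  shows "filterlim a at_top sequentially"
proof -
  obtain N where N: "\<And>n. n \<ge> N \<Longrightarrow> a n \<ge> 0 \<and> r * a n < a (Suc n)"
    using assms(2) unfolding eventually_sequentially by blast
  \<comment> \<open>The geometric growth starts one index late because \<open>a N\<close> may be
    \<open>0\<close>, whereas \<open>a (Suc N) > r * a N\<close> is strictly positive.\<close>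
  define c where "c = a (Suc N)"
  have c: "c > 0"
    using N[of N] assms(1) mult_nonneg_nonneg[of r "a N"] unfolding c_def by linarith
  have grow: "c * r ^ i \<le> a (i + Suc N)" for i
  proof (induction i)
    case (Suc i)
    then have "c * r ^ Suc i \<le> r * a (i + Suc N)"
      using assms(1) by (simp add: mult.commute mult.left_commute)
    also have "\<dots> < a (Suc i + Suc N)"
      using N[of "i + Suc N"] by simp
    finally show ?case by simp
  qed (simp add: c_def)
  have "filterlim (\<lambda>i. c * r ^ i) at_top sequentially"
    using c filterlim_realpow_sequentially_gt1[of r] assms(1)
    by (intro filterlim_tendsto_pos_mult_at_top[OF tendsto_const])
       (auto intro: filterlim_at_infinity_imp_filterlim_at_top)
  then have "filterlim (\<lambda>i. a (i + Suc N)) at_top sequentially"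
    by (rule filterlim_at_top_mono) (use grow in simp)
  then show ?thesis
    using eventually_sequentially_seg[of "\<lambda>n. Z \<le> a n" "Suc N" for Z]
    unfolding filterlim_at_top by blast
qed

text \<open>A block that contributes a prime up to \<open>s (2 * k)\<close> has index
  \<open>j < k\<close>, hence ends by \<open>s (2 * k - 1)\<close>.\<close>

lemma prime_pi_in_alternating_le:
  assumes "mono_on {1..} s" "k \<ge> 1"
  shows "prime_pi_in (alternating_primes s) (s (2 * k)) \<le> prime_pi (s (2 * k - 1))"
  unfolding prime_pi_def prime_pi_in_def
proof (intro card_mono finite_nat_real_le subsetI)
  fix q assume "q \<in> {q \<in> alternating_primes s. real q \<le> s (2 * k)}"
  then obtain j where j: "prime q" "j \<ge> 1" "s (2 * j) < real q" "real q < s (2 * j + 1)"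
      "real q \<le> s (2 * k)"
    unfolding alternating_primes_def by auto
  have "j < k"
    using mono_onD[OF assms(1), of "2 * k" "2 * j"] j assms(2) by force
  then have "s (2 * j + 1) \<le> s (2 * k - 1)"
    by (intro mono_onD[OF assms(1)]) auto
  with j show "q \<in> {q \<in> {q. prime q}. real q \<le> s (2 * k - 1)}"
    by simp
qed

text \<open>The blocks are open intervals, so \<open>s (2 * k + 1)\<close> itself may be a prime
  outside the set; the summand \<open>1\<close> pays for it.\<close>

lemma prime_pi_le_alternating:
  assumes "k \<ge> 1"
  shows "prime_pi (s (2 * k + 1))
    \<le> prime_pi_in (alternating_primes s) (s (2 * k + 1)) + prime_pi (s (2 * k)) + 1"
proof -
  let ?A = "{q \<in> alternating_primes s. real q \<le> s (2 * k + 1)}"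
  let ?B = "{q \<in> {q. prime q}. real q \<le> s (2 * k)}"
  \<comment> \<open>The only natural number that can equal the right endpoint; counting it when it
    is not a prime does no harm to an upper bound.\<close>
  let ?C = "{nat \<lfloor>s (2 * k + 1)\<rfloor>}"
  have "q \<in> ?A \<union> ?B \<union> ?C" if "prime q" "real q \<le> s (2 * k + 1)" for q
  proof (cases "real q = s (2 * k + 1)")
    case True
    then have "q = nat \<lfloor>s (2 * k + 1)\<rfloor>" by (metis floor_of_nat nat_int)
    then show ?thesis by simp
  next
    case False
    with that have lt: "real q < s (2 * k + 1)" by simp
    have "q \<in> alternating_primes s" if "s (2 * k) < real q"
      unfolding alternating_primes_def
    proof (intro IntI UN_I[of k] CollectI)
      show "real q \<in> {s (2 * k)<..<s (2 * k + 1)}" using that lt by simp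
    qed (use \<open>prime q\<close> assms in simp_all)
    with lt \<open>prime q\<close> show ?thesis by (cases "s (2 * k) < real q") auto
  qed
  then have "card {q \<in> {q. prime q}. real q \<le> s (2 * k + 1)} \<le> card (?A \<union> ?B \<union> ?C)"
    by (intro card_mono finite_UnI finite_nat_real_le) blast+
  also have "\<dots> \<le> card ?A + card ?B + card ?C"
    using card_Un_le[of "?A \<union> ?B" ?C] card_Un_le[of ?A ?B] by simp
  finally show ?thesis
    unfolding prime_pi_def prime_pi_in_def by simp
qed

theorem theorem7p6:
  fixes h :: "real \<Rightarrow> real" and s :: "nat \<Rightarrow> real"
  assumes "\<And>x. x > 0 \<Longrightarrow> h x \<ge> 0"
    and "continuous_on {0<..} h"
    and "\<not> bounded (h ` {0<..})"
    and "mono_on {0<..} h"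
    and "eventually_semi_additive h"
    and "mono_on {1..} s"
    and "h_thin h s"
  shows "\<not> has_h_density h (alternating_primes s)"
proof
  define S where "S = alternating_primes s"
  define a where "a n = h (real (prime_pi (s n)))" for n
  define f where "f n = h (real (prime_pi_in S (real n))) / h (real (prime_pi (real n)))" for n
  assume "has_h_density h (alternating_primes s)"
  then have eq: "liminf (\<lambda>n. ereal (f n)) = limsup (\<lambda>n. ereal (f n))"
    unfolding has_h_density_def lower_h_density_def upper_h_density_def f_def S_def .
  obtain r where r: "r > 3" and
    ev: "\<forall>\<^sub>F n in sequentially. prime_pi (s n) > 0 \<and> r * a n < a (Suc n)"
    using assms(7) unfolding h_thin_def a_def by blast
  obtain C where C: "C \<ge> 0" "\<And>a b. a > 0 \<Longrightarrow> b > 0 \<Longrightarrow> h (a + b) \<le> h a + h b + C"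
    using semi_additive_up_to_constant[OF assms(1,4,5)] by blast
  \<comment> \<open>The total error when \<open>h\<close> is split over three summands, the last of
    them \<open>1\<close>: two uses of the constant \<open>C\<close>, plus
    \<open>h 1\<close>.\<close>
  define D where "D = h 1 + 2 * C"
  have D: "h 1 + C \<le> D" "0 \<le> D"
    using C(1) assms(1)[of 1] by (auto simp: D_def)
  have h_mono: "h (real i) \<le> h (real j)" if "0 < i" "i \<le> j" for i j :: nat
    using that by (intro mono_onD[OF assms(4)]) auto
  have a_lim: "filterlim a at_top sequentially"
  proof (rule filterlim_at_top_of_ratio[of r])
    show "\<forall>\<^sub>F n in sequentially. a n \<ge> 0 \<and> r * a n < a (Suc n)"
      using ev by eventually_elim (auto simp: a_def intro: assms(1))
  qed (use r in simp)
  \<comment> \<open>If \<open>s n\<close> stayed below \<open>x\<close>, monotonicity would bound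
    \<open>a n\<close> by the fixed number \<open>h (real (prime_pi x))\<close>.\<close>
  have s_gt: "\<forall>\<^sub>F n in sequentially. s n > x" for x
  proof -
    have "\<forall>\<^sub>F n in sequentially. a n > h (real (prime_pi x))"
      using a_lim by (simp add: filterlim_at_top_dense)
    with ev show ?thesis
    proof eventually_elim
      case (elim n)
      show ?case
      proof (rule ccontr)
        assume "\<not> s n > x"
        then have "a n \<le> h (real (prime_pi x))"
          unfolding a_def using elim by (intro h_mono prime_pi_mono) auto
        with elim show False by simp
      qed
    qed
  qed
  have a_gt: "\<forall>\<^sub>F n in sequentially. a n > x" for x
    using a_lim by (simp add: filterlim_at_top_dense)
  \<comment> \<open>The factor \<open>6\<close> is chosen because
    \<open>1 - 1/3 - 1/6 = 1/2\<close>: at an odd index, the preceding term takes less than a third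
    of \<open>a (2 * k + 1)\<close> and the error \<open>D\<close> less than a sixth.\<close>
  have "\<forall>\<^sub>F n in sequentially. prime_pi (s n) > 0 \<and> r * a n < a (Suc n)
      \<and> a n > 6 * D \<and> a n > 0 \<and> s n \<ge> 0"
    using ev a_gt[of "6 * D"] a_gt[of 0] s_gt[of 0] by eventually_elim auto
  then obtain K where K: "\<And>n. n \<ge> K \<Longrightarrow> prime_pi (s n) > 0 \<and> r * a n < a (Suc n)
      \<and> a n > 6 * D \<and> a n > 0 \<and> s n \<ge> 0"
    unfolding eventually_sequentially by blast
  have three: "3 * a n < a (Suc n)" if "n \<ge> K" for n
    using K[OF that] r mult_strict_right_mono[of 3 r "a n"] by linarith
  have f_floor: "f (nat \<lfloor>s n\<rfloor>) = h (real (prime_pi_in S (s n))) / a n" if "n \<ge> K" for n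
    using K[OF that] unfolding f_def a_def prime_pi_def by (subst (1 2) prime_pi_in_nat_floor) simp_all

  have odd_idx: "prime_pi_in S (s (2 * k + 1)) > 0 \<and> f (nat \<lfloor>s (2 * k + 1)\<rfloor>) > 1 / 2"
    if k: "k \<ge> 1" "k \<ge> K" for k
  proof -
    let ?p = "prime_pi_in S (s (2 * k + 1))" and ?q = "prime_pi (s (2 * k))"
    have q: "?q > 0" and a3: "3 * a (2 * k) < a (2 * k + 1)"
      and aD: "a (2 * k) > 6 * D" "a (2 * k + 1) > 6 * D"
      and pos: "a (2 * k) > 0" "a (2 * k + 1) > 0"
      using K[of "2 * k"] K[of "2 * k + 1"] three[of "2 * k"] k by auto
    have le: "a (2 * k + 1) \<le> h (real (?p + ?q + 1))"
      unfolding a_def using prime_pi_le_alternating[OF k(1), of s] K[of "2 * k + 1"] k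
      by (intro h_mono) (auto simp: S_def)
    have q1: "h (real ?q + 1) \<le> a (2 * k) + h 1 + C"
      using C(2)[of "real ?q" 1] q by (simp add: a_def)
    \<comment> \<open>Nothing is known about \<open>h 0\<close>, so the count must be positive
      before \<open>h\<close> is split. An empty count would leave \<open>a (2 * k + 1)\<close>
      bounded by \<open>a (2 * k) + D\<close>, which is less than half of it.\<close>
    have p: "?p > 0"
    proof (rule ccontr)
      assume "\<not> ?p > 0"
      then have "a (2 * k + 1) \<le> h (real ?q + 1)"
        using le by (simp add: add.commute)
      then show False
        using q1 a3 aD pos D by linarith
    qed
    have "h (real (?p + ?q + 1)) \<le> h (real ?p) + h (real ?q + 1) + C"
      using C(2)[of "real ?p" "real ?q + 1"] p q by (simp add: add.assoc add.commute)
    then have "a (2 * k + 1) \<le> h (real ?p) + a (2 * k) + D"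
      using le q1 unfolding D_def by linarith
    then have "h (real ?p) > a (2 * k + 1) / 2"
      using a3 aD by linarith
    then have "f (nat \<lfloor>s (2 * k + 1)\<rfloor>) > 1 / 2"
      using k pos by (subst f_floor) (simp_all add: less_divide_eq)
    with p show ?thesis by simp
  qed

  have even_idx: "f (nat \<lfloor>s (2 * k)\<rfloor>) < 1 / 3" if k: "k \<ge> K + 2" for k
  proof -
    let ?p = "prime_pi_in S (s (2 * k))"
    \<comment> \<open>Positivity of the count, needed for monotonicity of \<open>h\<close>, is
      inherited from the preceding odd index. The bound \<open>K + 2\<close> ensures both
      \<open>k - 1 \<ge> 1\<close> and \<open>k - 1 \<ge> K\<close>.\<close>
    have "prime_pi_in S (s (2 * (k - 1) + 1)) \<le> ?p"
      using k by (intro prime_pi_in_mono mono_onD[OF assms(6)]) auto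
    moreover have "prime_pi_in S (s (2 * (k - 1) + 1)) > 0"
      by (rule odd_idx[THEN conjunct1]) (use k in auto)
    ultimately have "?p > 0" by linarith
    then have "h (real ?p) \<le> a (2 * k - 1)"
      unfolding a_def S_def using prime_pi_in_alternating_le[OF assms(6), of k] k
      by (intro h_mono) auto
    moreover have "3 * a (2 * k - 1) < a (2 * k)"
      using three[of "2 * k - 1"] k by simp
    ultimately have "3 * h (real ?p) < a (2 * k)" by linarith
    then show ?thesis
      using K[of "2 * k"] k by (subst f_floor) (simp_all add: divide_less_eq)
  qed

  \<comment> \<open>The sample points pass every threshold, so the bounds at even and at odd indices
    each hold at arbitrarily large natural arguments, as \<open>liminf\<close> and
    \<open>limsup\<close> require.\<close>
  have far: "\<exists>k0. \<forall>n\<ge>k0. nat \<lfloor>s n\<rfloor> \<ge> N" for N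
    using s_gt[of "real N"] le_nat_floor[OF less_imp_le] unfolding eventually_sequentially by blast

  have "liminf (\<lambda>n. ereal (f n)) \<le> ereal (1 / 3)"
  proof (rule ccontr)
    assume "\<not> ?thesis"
    then have "\<forall>\<^sub>F n in sequentially. ereal (1 / 3) < ereal (f n)"
      by (intro less_LiminfD) (simp add: not_le)
    then obtain N where N: "\<And>n. n \<ge> N \<Longrightarrow> 1 / 3 < f n"
      unfolding eventually_sequentially by auto
    obtain k0 where "\<And>n. n \<ge> k0 \<Longrightarrow> nat \<lfloor>s n\<rfloor> \<ge> N" using far by blast
    \<comment> \<open>The index is even, beyond \<open>k0\<close>, and large enough for
      \<open>even_idx\<close>, which asserts the opposite inequality.\<close>
    then have "f (nat \<lfloor>s (2 * (K + 2 + k0))\<rfloor>) > 1 / 3" by (intro N) simp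
    with even_idx[of "K + 2 + k0"] show False by simp
  qed
  moreover have "limsup (\<lambda>n. ereal (f n)) \<ge> ereal (1 / 2)"
  proof (rule ccontr)
    assume "\<not> ?thesis"
    then have "\<forall>\<^sub>F n in sequentially. ereal (f n) < ereal (1 / 2)"
      by (intro Limsup_lessD) (simp add: not_le)
    then obtain N where N: "\<And>n. n \<ge> N \<Longrightarrow> f n < 1 / 2"
      unfolding eventually_sequentially by auto
    obtain k0 where "\<And>n. n \<ge> k0 \<Longrightarrow> nat \<lfloor>s n\<rfloor> \<ge> N" using far by blast
    then have "f (nat \<lfloor>s (2 * (K + 1 + k0) + 1)\<rfloor>) < 1 / 2" by (intro N) simp
    with odd_idx[of "K + 1 + k0"] show False by simp
  qed
  ultimately have "ereal (1 / 2) \<le> ereal (1 / 3)"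
    unfolding eq using order_trans by blast
  then show False
    by simp
qed

end
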